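(* For every integer $n\geq 3$, $$R(K_n\sqcup K_n)=n-1.$$ That is, every total order on the edges of $K_n\sqcup K_n$ is realizable in $\mathbb{R}^{n-1}$, while some total orders on the edges of $K_n\sqcup K_n$ are not realizable in $\mathbb{R}^{n-2}$.
   Context: Graphs are finite and simple. For a graph $G=(V,E)$ and a total order $\prec$ on $E$, we say that $\prec$ is realizable in $\mathbb{R}^d$ if there is an injection $p\colon V\to\mathbb{R}^d$ such that the Euclidean edge lengths $\|p(u)-p(v)\|$, $uv\in E$, are pairwise distinct and, for all distinct edges $uv,xy\in E$, $uv\prec xy$ if and only if $\|p(u)-p(v)\|<\|p(x)-p(y)\|$. The parameter $R(G)$ is defined as $R(G)=\min\{d : \text{every total order on } E(G) \text{ is realizable in } \mathbb{R}^d\}$. $K_n\sqcup K_n$ denotes the disjoint union of two copies of the complete graph on $n$ vertices; a total order on its edges compares all edges, including edges from different components. *)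

theory Defs
  imports "HOL-Analysis.Analysis"
begin

record 'a graph =
  verts :: "'a set"
  edges :: "'a set set"

definition finite_simple_graph :: "'a graph \<Rightarrow> bool" where
  "finite_simple_graph G \<longleftrightarrow>
     finite (verts G) \<and> (\<forall>e\<in>edges G. e \<subseteq> verts G \<and> card e = 2)"

definition complete_graph :: "nat \<Rightarrow> nat graph" where
  "complete_graph n = \<lparr>verts = {..<n}, edges = {e. e \<subseteq> {..<n} \<and> card e = 2}\<rparr>"

definition disjoint_union_graph :: "'a graph \<Rightarrow> 'b graph \<Rightarrow> ('a + 'b) graph" where
  "disjoint_union_graph G H =
     \<lparr>verts = verts G <+> verts H,
      edges = image Inl ` edges G \<union> image Inr ` edges H\<rparr>"

lemma finite_simple_graph_complete: "finite_simple_graph (complete_graph n)"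
  by (simp add: finite_simple_graph_def complete_graph_def)

lemma finite_simple_graph_disjoint_union:
  "finite_simple_graph G \<Longrightarrow> finite_simple_graph H \<Longrightarrow>
     finite_simple_graph (disjoint_union_graph G H)"
  by (auto simp: finite_simple_graph_def disjoint_union_graph_def card_image)

text \<open>Points of \<^term>\<open>Euclidean_space d\<close> are sequences vanishing from index \<open>d\<close> on, so the
  dimension can be quantified over; the first \<open>d\<close> coordinates determine the Euclidean distance.\<close>

definition euclid_dist :: "nat \<Rightarrow> (nat \<Rightarrow> real) \<Rightarrow> (nat \<Rightarrow> real) \<Rightarrow> real" where
  "euclid_dist d x y = L2_set (\<lambda>i. x i - y i) {..<d}"

definition edge_order :: "'a graph \<Rightarrow> 'a set rel \<Rightarrow> bool" where
  "edge_order G r \<longleftrightarrow> r \<subseteq> edges G \<times> edges G \<and> strict_linear_order_on (edges G) r"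

definition realizable :: "'a graph \<Rightarrow> 'a set rel \<Rightarrow> nat \<Rightarrow> bool" where
  "realizable G r d \<longleftrightarrow>
     (\<exists>p. p \<in> verts G \<rightarrow> topspace (Euclidean_space d) \<and> inj_on p (verts G) \<and>
        (\<forall>u v x y. {u, v} \<in> edges G \<and> {x, y} \<in> edges G \<and> {u, v} \<noteq> {x, y} \<longrightarrow>
           euclid_dist d (p u) (p v) \<noteq> euclid_dist d (p x) (p y) \<and>
           (({u, v}, {x, y}) \<in> r \<longleftrightarrow>
              euclid_dist d (p u) (p v) < euclid_dist d (p x) (p y))))"

text \<open>\<open>LEAST\<close> is unspecified when no dimension satisfies the predicate, so an equation
  \<open>realization_dim G = d\<close> carries its intended meaning only together with the realizability of
  every edge order in some dimension.\<close>

definition realization_dim :: "'a graph \<Rightarrow> nat" where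
  "realization_dim G = (LEAST d. \<forall>r. edge_order G r \<longrightarrow> realizable G r d)"

end

theory Submission
  imports Defs
begin

text \<open>
  Everything is phrased through squared distances, which order the edges in the same way as the
  distances.

  Why \<open>n - 1\<close> dimensions suffice: the regular simplex with \<open>n\<close> vertices lives there, and its squared
  edge lengths can be perturbed independently to first order (\<open>perturbed_regular_simplex\<close>). Moving
  each copy of the simplex so that the squared length of an edge grows in proportion to the rank of
  that edge realizes any order of all edges, for a small enough perturbation. A translation of one
  copy makes the points distinct.

  Why \<open>n - 2\<close> dimensions do not suffice: both bounds come from the identity
  \<open>\<Sum>\<^sub>i \<Sum>\<^sub>j c\<^sub>i c\<^sub>j |x\<^sub>i - x\<^sub>j|\<^sup>2 = - 2 |\<Sum>\<^sub>i c\<^sub>i x\<^sub>i|\<^sup>2\<close>, valid whenever the weights sum to zero. Put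
  \<open>s = n div 2\<close>, \<open>t = n - s\<close> and \<open>\<kappa> = 1 - 1 / (2 s) - 1 / (2 t)\<close>.

  \<^item> In \<open>n - 2\<close> dimensions \<open>n\<close> points are affinely dependent, and the identity for the coefficients of
    a dependence shows that the least squared distance is at most \<open>\<kappa>\<close> times the greatest
    (\<open>spread_of_dependent_points\<close>).

  \<^item> In any dimension, split \<open>n\<close> points into classes of sizes \<open>s\<close> and \<open>t\<close>. Comparing the two class
    centroids shows that the squared distances across the classes cannot all be smaller than \<open>m\<close>
    while those inside the classes are at least \<open>M\<close>, unless \<open>\<kappa> M < m\<close>
    (\<open>bipartite_gap_upper_bound\<close>).

  Consider an order in which all edges of the second copy come after the edges of the first copy that
  cross such a split, and before the other edges of the first copy. With \<open>m\<close> and \<open>M\<close> the least and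
  the greatest squared distance of the second copy, a realization in \<open>n - 2\<close> or fewer dimensions
  would satisfy both \<open>m \<le> \<kappa> M\<close> and \<open>\<kappa> M < m\<close>.
\<close>

section \<open>Quadratic forms of squared distances\<close>

abbreviation sq_dist :: "nat \<Rightarrow> (nat \<Rightarrow> real) \<Rightarrow> (nat \<Rightarrow> real) \<Rightarrow> real" where
  "sq_dist d x y \<equiv> (\<Sum>k<d. (x k - y k)\<^sup>2)"

lemma euclid_dist_less_iff: "euclid_dist d x y < euclid_dist d u v \<longleftrightarrow> sq_dist d x y < sq_dist d u v"
  by (simp add: euclid_dist_def L2_set_def)

lemma euclid_dist_eq_iff: "euclid_dist d x y = euclid_dist d u v \<longleftrightarrow> sq_dist d x y = sq_dist d u v"
  by (simp add: euclid_dist_def L2_set_def)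

text \<open>Expanding \<open>(y\<^sub>i - y\<^sub>j)\<^sup>2\<close> in each coordinate, the two pure squares are annihilated by the vanishing sum of
  the weights and only the mixed term survives. The right-hand side is nonpositive in general, and zero
  exactly for an affine dependence.\<close>

lemma weighted_sum_sq_dist:
  fixes c :: "'i \<Rightarrow> real" and x :: "'i \<Rightarrow> nat \<Rightarrow> real"
  assumes "sum c I = 0"
  shows "(\<Sum>i\<in>I. \<Sum>j\<in>I. c i * c j * sq_dist d (x i) (x j)) = - 2 * (\<Sum>k<d. (\<Sum>i\<in>I. c i * x i k)\<^sup>2)"
proof -
  have coord: "(\<Sum>i\<in>I. \<Sum>j\<in>I. c i * c j * (y i - y j)\<^sup>2) = - 2 * (\<Sum>i\<in>I. c i * y i)\<^sup>2" for y :: "'i \<Rightarrow> real"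
  proof -
    have "(\<Sum>i\<in>I. \<Sum>j\<in>I. c i * c j * (y i - y j)\<^sup>2)
        = (\<Sum>i\<in>I. \<Sum>j\<in>I. (c i * (y i)\<^sup>2) * c j + c i * (c j * (y j)\<^sup>2) - 2 * ((c i * y i) * (c j * y j)))"
      by (intro sum.cong refl) (simp add: power2_eq_square algebra_simps)
    also have "\<dots> = (\<Sum>i\<in>I. c i * (y i)\<^sup>2) * sum c I + sum c I * (\<Sum>i\<in>I. c i * (y i)\<^sup>2)
        - 2 * ((\<Sum>i\<in>I. c i * y i) * (\<Sum>i\<in>I. c i * y i))"
      by (simp only: sum.distrib sum_subtractf sum_distrib_left[symmetric] sum_distrib_right[symmetric])
    finally show ?thesis using assms by (simp add: power2_eq_square)
  qed
  have "(\<Sum>i\<in>I. \<Sum>j\<in>I. c i * c j * sq_dist d (x i) (x j))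
      = (\<Sum>i\<in>I. \<Sum>j\<in>I. \<Sum>k<d. c i * c j * (x i k - x j k)\<^sup>2)"
    by (simp add: sum_distrib_left)
  also have "\<dots> = (\<Sum>i\<in>I. \<Sum>k<d. \<Sum>j\<in>I. c i * c j * (x i k - x j k)\<^sup>2)"
    by (intro sum.cong refl sum.swap)
  also have "\<dots> = (\<Sum>k<d. \<Sum>i\<in>I. \<Sum>j\<in>I. c i * c j * (x i k - x j k)\<^sup>2)"
    by (rule sum.swap)
  finally show ?thesis by (simp add: coord sum_distrib_left)
qed

text \<open>The comparison matrix for squared distances: \<open>M\<close> inside the classes \<open>S\<close> and \<open>I - S\<close>, \<open>m\<close> across them,
  \<open>0\<close> on the diagonal. Each class contributes the square of its total weight, which is \<open>1\<close>, and the
  diagonal has to be removed from the \<open>M\<close>-part.\<close>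

lemma two_level_form:
  fixes c :: "'i \<Rightarrow> real"
  assumes "finite I" "S \<subseteq> I" "sum c S = 1" "sum c (I - S) = - 1"
  shows "(\<Sum>i\<in>I. \<Sum>j\<in>I. c i * c j * (if i = j then 0 else if i \<in> S \<longleftrightarrow> j \<in> S then M else m))
    = M * (2 - (\<Sum>i\<in>I. (c i)\<^sup>2)) - 2 * m"
proof -
  define s t where "s i = (if i \<in> S then c i else 0)" and "t i = (if i \<in> I - S then c i else 0)" for i
  have "sum s I = sum c S" unfolding s_def
    using assms(1,2) by (simp add: sum.If_cases Int_absorb1)
  then have s: "sum s I = 1" using assms by simp
  have "sum t I = sum c (I - S)" unfolding t_def
    using assms(1) by (subst sum.inter_restrict[symmetric]) (auto intro: sum.cong)
  then have t: "sum t I = -1" using assms by simp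
  have "sum c I = (\<Sum>i\<in>I. s i + t i)"
    by (intro sum.cong) (auto simp: s_def t_def)
  then have c0: "sum c I = 0" using s t by (simp add: sum.distrib)
  have "(\<Sum>i\<in>I. \<Sum>j\<in>I. c i * c j * (if i = j then 0 else if i \<in> S \<longleftrightarrow> j \<in> S then M else m))
    = (\<Sum>i\<in>I. \<Sum>j\<in>I. m * (c i * c j) + (M - m) * (s i * s j) + (M - m) * (t i * t j)
         - (if i = j then M * (c i)\<^sup>2 else 0))"
    by (intro sum.cong refl) (auto simp: s_def t_def power2_eq_square algebra_simps)
  also have "\<dots> = m * (sum c I * sum c I) + (M - m) * (sum s I * sum s I) + (M - m) * (sum t I * sum t I)
       - (\<Sum>i\<in>I. M * (c i)\<^sup>2)"
    using assms(1)
    by (simp add: sum.distrib sum_subtractf flip: sum_distrib_left sum_distrib_right)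
  finally show ?thesis by (simp add: s t c0 algebra_simps sum_distrib_left)
qed

section \<open>Spread of affinely dependent points\<close>

text \<open>Gaussian elimination: pivot on an unknown \<open>i0\<close> that occurs in the last equation, solve the reduced
  system without \<open>i0\<close>, and recover the value of \<open>i0\<close> from the last equation.\<close>

lemma homogeneous_system_nontrivial_solution:
  fixes a :: "nat \<Rightarrow> 'i \<Rightarrow> 'a::field"
  assumes "finite I" "k < card I"
  shows "\<exists>c. (\<exists>i\<in>I. c i \<noteq> 0) \<and> (\<forall>j<k. (\<Sum>i\<in>I. c i * a j i) = 0)"
  using assms
proof (induction k arbitrary: I a)
  case 0
  then have "I \<noteq> {}" by auto
  then show ?case by (intro exI[of _ "\<lambda>_. 1"]) auto
next
  case (Suc k)
  show ?case
  proof (cases "\<forall>i\<in>I. a k i = 0")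
    case True
    obtain c where "\<exists>i\<in>I. c i \<noteq> 0" "\<forall>j<k. (\<Sum>i\<in>I. c i * a j i) = 0"
      using Suc.IH[of I a] Suc.prems by auto
    then show ?thesis using True by (intro exI[of _ c]) (auto simp: less_Suc_eq)
  next
    case False
    then obtain i0 where i0: "i0 \<in> I" "a k i0 \<noteq> 0" by auto
    let ?J = "I - {i0}"
    have "k < card ?J" using Suc.prems i0(1) by simp
    then obtain c where c: "\<exists>i\<in>?J. c i \<noteq> 0"
      and eq: "\<forall>j<k. (\<Sum>i\<in>?J. c i * (a j i - a j i0 * a k i / a k i0)) = 0"
      using Suc.IH[of ?J "\<lambda>j i. a j i - a j i0 * a k i / a k i0"] Suc.prems(1) by blast
    define y where "y = (\<Sum>i\<in>?J. c i * a k i) / a k i0"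
    define c' where "c' = c(i0 := - y)"
    have split: "(\<Sum>i\<in>I. c' i * a j i) = (\<Sum>i\<in>?J. c i * a j i) - y * a j i0" for j
      using Suc.prems(1) i0(1) by (simp add: sum.remove c'_def)
    have "(\<Sum>i\<in>I. c' i * a j i) = 0" if "j < Suc k" for j
    proof (cases "j = k")
      case True
      then show ?thesis using i0 unfolding split by (simp add: y_def)
    next
      case False
      then have "(\<Sum>i\<in>?J. c i * (a j i - a j i0 * a k i / a k i0)) = 0" using eq that by simp
      moreover have "(\<Sum>i\<in>?J. c i * (a j i - a j i0 * a k i / a k i0)) =
          (\<Sum>i\<in>?J. c i * a j i) - y * a j i0"
        by (simp add: y_def right_diff_distrib sum_subtractf sum_divide_distrib sum_distrib_left
            sum_distrib_right mult_ac)
      ultimately show ?thesis unfolding split by simp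
    qed
    moreover have "\<exists>i\<in>I. c' i \<noteq> 0" using c by (auto simp: c'_def)
    ultimately show ?thesis by blast
  qed
qed

text \<open>Vanishing of the \<open>d\<close> coordinates and of the sum of the coefficients are \<open>d + 1\<close> linear conditions on
  at least \<open>d + 2\<close> coefficients. Rescaling then makes the positive coefficients sum to \<open>1\<close>: this is
  the dependence behind a Radon partition.\<close>

lemma normalized_affine_dependence:
  fixes x :: "'i \<Rightarrow> nat \<Rightarrow> real"
  assumes "finite I" "d + 2 \<le> card I"
  obtains c where "sum c {i\<in>I. c i > 0} = 1" "sum c (I - {i\<in>I. c i > 0}) = - 1"
    "\<And>k. k < d \<Longrightarrow> (\<Sum>i\<in>I. c i * x i k) = 0"
proof -
  \<comment> \<open>Row \<open>d\<close> of the system, constantly \<open>1\<close>, makes the coefficients sum to zero.\<close>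
  obtain b :: "'i \<Rightarrow> real" where b: "\<exists>i\<in>I. b i \<noteq> 0"
    and eq: "\<And>k. k < Suc d \<Longrightarrow> (\<Sum>i\<in>I. b i * (if k = d then 1 else x i k)) = 0"
    using homogeneous_system_nontrivial_solution[of I "Suc d" "\<lambda>k i. if k = d then 1 else x i k"] assms
    by auto
  have b0: "sum b I = 0" using eq[of d] by simp
  define P where "P = {i\<in>I. b i > 0}"
  define s where "s = sum b P"
  have P: "P \<subseteq> I" by (auto simp: P_def)
  have rest: "sum b (I - P) = - s"
    using sum.subset_diff[OF P assms(1), of b] b0 by (simp add: s_def)
  have "s \<ge> 0" unfolding s_def by (rule sum_nonneg) (auto simp: P_def)
  moreover have "s \<noteq> 0"
  proof
    assume "s = 0"
    have "\<forall>i\<in>P. b i = 0"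
      using \<open>s = 0\<close> sum_nonneg_eq_0_iff[of P b] assms(1) by (auto simp: s_def P_def)
    moreover have nonpos: "b i \<le> 0" if "i \<in> I - P" for i using that by (auto simp: P_def)
    have "\<forall>i\<in>I - P. b i = 0"
      using rest \<open>s = 0\<close> sum_nonneg_eq_0_iff[of "I - P" "\<lambda>i. - b i"] assms(1)
      by (simp add: sum_negf nonpos)
    ultimately show False using b by blast
  qed
  ultimately have s: "s > 0" by simp
  define c where "c i = b i / s" for i
  have pos: "{i\<in>I. c i > 0} = P" using s by (auto simp: c_def P_def zero_less_divide_iff)
  show ?thesis
  proof (rule that[of c], unfold pos)
    have "sum c A = sum b A / s" for A unfolding c_def by (rule sum_divide_distrib[symmetric])
    then show "sum c P = 1" "sum c (I - P) = - 1" using s rest by (simp_all flip: s_def)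
    fix k assume "k < d"
    then have "(\<Sum>i\<in>I. b i * x i k) / s = 0" using eq[of k] by simp
    then show "(\<Sum>i\<in>I. c i * x i k) = 0" by (simp add: c_def sum_divide_distrib)
  qed
qed

lemma sum_squares_ge_inverse_card:
  fixes c :: "'i \<Rightarrow> real"
  assumes "finite S" "\<bar>sum c S\<bar> = 1"
  shows "1 / card S \<le> (\<Sum>i\<in>S. (c i)\<^sup>2)"
proof -
  have "S \<noteq> {}" using assms(2) by auto
  then have "card S > 0" using assms(1) by (simp add: card_gt_0_iff)
  moreover have "(sum c S)\<^sup>2 = 1" using assms(2) by (metis power2_abs one_power2)
  ultimately show ?thesis
    using sum_squared_le_sum_of_squares[of c S] assms(1) by (simp add: field_simps)
qed

text \<open>If \<open>p\<close> deviates by \<open>k\<close> from the smaller half \<open>s\<close>, then \<open>p q = s t + k (t - s) - k\<^sup>2\<close> with \<open>t - s \<in> {0, 1}\<close>,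
  and \<open>k \<le> k\<^sup>2\<close> for every integer \<open>k\<close>.\<close>

lemma balanced_product_max:
  fixes p q :: nat
  shows "p * q \<le> ((p + q) div 2) * (p + q - (p + q) div 2)"
proof -
  define s t where "s = int ((p + q) div 2)" and "t = int (p + q) - s"
  define k where "k = int p - s"
  have ts: "t - s = 0 \<or> t - s = 1" unfolding s_def t_def by presburger
  have "k \<le> k * k"
    by (cases "k \<le> 0") (use order_trans[of k 0 "k*k"] in \<open>auto simp: mult_le_cancel_left1 mult_le_cancel_right1\<close>)
  then have "k * (t - s) \<le> k * k" using ts by auto
  moreover have "int p * int q = s * t + k * (t - s) - k * k"
    by (simp add: k_def t_def algebra_simps)
  ultimately have "int p * int q \<le> s * t" by simp
  then have "int (p * q) \<le> int (((p + q) div 2) * (p + q - (p + q) div 2))"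
    by (simp add: s_def t_def of_nat_diff)
  then show ?thesis by linarith
qed

text \<open>Replace the squared distances in the identity for a dependence \<open>c\<close> by their extremes, \<open>M\<close> for pairs of
  equal sign and \<open>m\<close> for pairs of opposite sign. This gives \<open>2 m \<le> M (2 - \<Sum> c\<^sub>i\<^sup>2)\<close>. By Cauchy--Schwarz
  on each sign class, \<open>\<Sum> c\<^sub>i\<^sup>2\<close> is at least \<open>1 / p + 1 / q = n / (p q)\<close> for the class sizes \<open>p\<close> and \<open>q\<close>, which
  is smallest for the balanced partition. Two regular simplices on the two halves, in orthogonal
  subspaces with a common centre, attain the bound.\<close>

lemma spread_of_dependent_points:
  fixes x :: "nat \<Rightarrow> nat \<Rightarrow> real"
  assumes dim: "d + 2 \<le> n" and M: "0 \<le> M"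
    and bounds: "\<And>i j. i < n \<Longrightarrow> j < n \<Longrightarrow> i \<noteq> j \<Longrightarrow>
      m \<le> sq_dist d (x i) (x j) \<and> sq_dist d (x i) (x j) \<le> M"
  shows "2 * m \<le> M * (2 - (1 / real (n div 2) + 1 / real (n - n div 2)))"
proof -
  let ?I = "{..<n}"
  obtain c where c: "sum c {i\<in>?I. c i > 0} = 1" "sum c (?I - {i\<in>?I. c i > 0}) = - 1"
    "\<And>k. k < d \<Longrightarrow> (\<Sum>i\<in>?I. c i * x i k) = 0"
    using normalized_affine_dependence[of ?I d x] dim by auto
  define S where "S = {i\<in>?I. c i > 0}"
  have S: "S \<subseteq> ?I" "finite S" by (auto simp: S_def)
  have cS: "sum c S = 1" "sum c (?I - S) = - 1" using c by (simp_all add: S_def)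
  have c0: "sum c ?I = 0" using sum.subset_diff[OF S(1), of c] cS by simp
  have "0 = (\<Sum>i\<in>?I. \<Sum>j\<in>?I. c i * c j * sq_dist d (x i) (x j))"
    using c(3) by (simp add: weighted_sum_sq_dist[OF c0])
  also have "\<dots> \<le> (\<Sum>i\<in>?I. \<Sum>j\<in>?I. c i * c j * (if i = j then 0 else if i \<in> S \<longleftrightarrow> j \<in> S then M else m))"
  proof (intro sum_mono)
    fix i j assume ij: "i \<in> ?I" "j \<in> ?I"
    show "c i * c j * sq_dist d (x i) (x j)
      \<le> c i * c j * (if i = j then 0 else if i \<in> S \<longleftrightarrow> j \<in> S then M else m)"
    proof (cases "i = j")
      case False
      have "(i \<in> S \<longleftrightarrow> j \<in> S) \<longrightarrow> c i * c j \<ge> 0" "\<not> (i \<in> S \<longleftrightarrow> j \<in> S) \<longrightarrow> c i * c j \<le> 0"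
        using ij by (auto simp: S_def mult_nonneg_nonpos mult_nonpos_nonneg not_less mult_nonpos_nonpos)
      then show ?thesis using False bounds[of i j] ij
        by (auto intro: mult_left_mono mult_left_mono_neg)
    qed simp
  qed
  also have "\<dots> = M * (2 - (\<Sum>i\<in>?I. (c i)\<^sup>2)) - 2 * m"
    by (rule two_level_form) (use S cS in auto)
  finally have form: "2 * m \<le> M * (2 - (\<Sum>i\<in>?I. (c i)\<^sup>2))" by simp
  define p q where "p = card S" and "q = card (?I - S)"
  have pq: "p + q = n" using card_mono[OF _ S(1)] S by (simp add: p_def q_def card_Diff_subset)
  have "S \<noteq> {}" "?I - S \<noteq> {}" using cS by (metis sum.empty zero_neq_one, metis sum.empty neg_0_equal_iff_equal zero_neq_one)
  then have pos: "p > 0" "q > 0" using S by (auto simp: p_def q_def card_gt_0_iff)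
  have "1 / p + 1 / q \<le> (\<Sum>i\<in>S. (c i)\<^sup>2) + (\<Sum>i\<in>?I - S. (c i)\<^sup>2)"
    unfolding p_def q_def by (intro add_mono sum_squares_ge_inverse_card) (use S cS in auto)
  also have "\<dots> = (\<Sum>i\<in>?I. (c i)\<^sup>2)"
    using sum.subset_diff[OF S(1), of "\<lambda>i. (c i)\<^sup>2"] by simp
  finally have sq: "1 / p + 1 / q \<le> (\<Sum>i\<in>?I. (c i)\<^sup>2)" .
  define s t where "s = n div 2" and "t = n - n div 2"
  have st: "s > 0" "t > 0" "s + t = n" using dim by (auto simp: s_def t_def)
  have "real (p * q) \<le> real (s * t)"
    using balanced_product_max[of p q] unfolding pq s_def t_def by (simp only: of_nat_le_iff)
  then have "real n / (real s * real t) \<le> real n / (real p * real q)"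
    using pos st by (intro divide_left_mono) auto
  moreover have "1 / real s + 1 / real t = real n / (real s * real t)"
    using st(1,2) by (simp add: field_simps flip: st(3))
  moreover have "1 / real p + 1 / real q = real n / (real p * real q)"
    using pos by (simp add: field_simps flip: pq)
  ultimately have "1 / real s + 1 / real t \<le> (\<Sum>i\<in>?I. (c i)\<^sup>2)" using sq by linarith
  then have "M * (2 - (\<Sum>i\<in>?I. (c i)\<^sup>2)) \<le> M * (2 - (1 / real s + 1 / real t))"
    using M by (intro mult_left_mono) auto
  then show ?thesis using form by (simp add: s_def t_def)
qed

text \<open>With weights \<open>1 / s\<close> on the first class and \<open>- 1 / (n - s)\<close> on the second, the identity says that the
  squared distance of the class centroids is nonnegative. At uniform weights the bound
  \<open>\<Sum> c\<^sub>i\<^sup>2 \<ge> 1 / s + 1 / (n - s)\<close> used for dependent points is an equality, which is why the two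
  inequalities meet exactly.\<close>

lemma bipartite_gap_upper_bound:
  fixes x :: "nat \<Rightarrow> nat \<Rightarrow> real"
  assumes s: "0 < s" "s < n"
    and across: "\<And>i j. i < s \<Longrightarrow> s \<le> j \<Longrightarrow> j < n \<Longrightarrow> sq_dist d (x i) (x j) < m"
    and within: "\<And>i j. i < n \<Longrightarrow> j < n \<Longrightarrow> i \<noteq> j \<Longrightarrow> i < s \<longleftrightarrow> j < s \<Longrightarrow> M \<le> sq_dist d (x i) (x j)"
  shows "M * (2 - (1 / real s + 1 / real (n - s))) < 2 * m"
proof -
  let ?I = "{..<n}"
  define t where "t = n - s"
  have t: "t > 0" using s by (simp add: t_def)
  define c :: "nat \<Rightarrow> real" where "c i = (if i < s then 1 / s else - 1 / t)" for i
  define h where "h i j = (if i = j then 0 else if i \<in> {..<s} \<longleftrightarrow> j \<in> {..<s} then M else m)" for i j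
  have S: "{..<s} \<subseteq> ?I" using s by auto
  have diff: "?I - {..<s} = {s..<n}" by auto
  have cS: "sum c {..<s} = 1" using s by (simp add: c_def)
  have cT: "sum c (?I - {..<s}) = - 1" unfolding diff using t by (simp add: c_def t_def)
  have c0: "sum c ?I = 0" using sum.subset_diff[OF S, of c] cS cT by simp
  have "(\<Sum>i\<in>?I. (c i)\<^sup>2) = (\<Sum>i\<in>{..<s}. (c i)\<^sup>2) + (\<Sum>i\<in>{s..<n}. (c i)\<^sup>2)"
    using sum.subset_diff[OF S, of "\<lambda>i. (c i)\<^sup>2"] diff by simp
  also have "\<dots> = 1 / s + 1 / t"
    using s t by (simp add: c_def t_def power2_eq_square)
  finally have sq: "(\<Sum>i\<in>?I. (c i)\<^sup>2) = 1 / s + 1 / t" .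
  have le: "c i * c j * h i j \<le> c i * c j * sq_dist d (x i) (x j)" if "i < n" "j < n" for i j
  proof (cases "i = j")
    case False
    have "sq_dist d (x j) (x i) = sq_dist d (x i) (x j)" by (simp add: power2_commute)
    then have hi: "if i < s \<longleftrightarrow> j < s then h i j \<le> sq_dist d (x i) (x j) else sq_dist d (x i) (x j) \<le> h i j"
      using False within[of i j] across[of i j] across[of j i] that by (auto simp: h_def not_less)
    have "if i < s \<longleftrightarrow> j < s then c i * c j \<ge> 0 else c i * c j \<le> 0"
      by (auto simp: c_def)
    then show ?thesis using hi
      by (auto intro: mult_left_mono mult_left_mono_neg split: if_splits)
  qed (simp add: h_def)
  \<comment> \<open>The pair of \<open>0\<close> and \<open>s\<close> crosses the classes and makes the inequality strict.\<close>
  have "c 0 * c s < 0" using s t by (simp add: c_def)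
  then have lt: "c 0 * c s * h 0 s < c 0 * c s * sq_dist d (x 0) (x s)"
    using across[of 0 s] s by (auto simp: h_def mult_less_cancel_left_neg)
  have "M * (2 - (\<Sum>i\<in>?I. (c i)\<^sup>2)) - 2 * m = (\<Sum>i\<in>?I. \<Sum>j\<in>?I. c i * c j * h i j)"
    unfolding h_def by (rule two_level_form[symmetric]) (use S cS cT in auto)
  also have "\<dots> < (\<Sum>i\<in>?I. \<Sum>j\<in>?I. c i * c j * sq_dist d (x i) (x j))"
  proof (rule sum_strict_mono_ex1)
    show "\<forall>i\<in>?I. (\<Sum>j\<in>?I. c i * c j * h i j) \<le> (\<Sum>j\<in>?I. c i * c j * sq_dist d (x i) (x j))"
      using le by (auto intro!: sum_mono)
    have "(\<Sum>j\<in>?I. c 0 * c j * h 0 j) < (\<Sum>j\<in>?I. c 0 * c j * sq_dist d (x 0) (x j))"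
      by (rule sum_strict_mono_ex1) (use le lt s in auto)
    then show "\<exists>i\<in>?I. (\<Sum>j\<in>?I. c i * c j * h i j) < (\<Sum>j\<in>?I. c i * c j * sq_dist d (x i) (x j))"
      using s by (intro bexI[of _ 0]) auto
  qed simp
  also have "\<dots> \<le> 0" by (simp add: weighted_sum_sq_dist[OF c0] sum_nonneg)
  finally show ?thesis unfolding sq t_def by (simp del: of_nat_diff)
qed

section \<open>Edges and edge orders\<close>

lemma edge_simps:
  fixes n :: nat
  defines "E \<equiv> edges (disjoint_union_graph (complete_graph n) (complete_graph n))"
  shows "{Inl i, Inl j} \<in> E \<longleftrightarrow> i < n \<and> j < n \<and> i \<noteq> j"
    and "{Inr i, Inr j} \<in> E \<longleftrightarrow> i < n \<and> j < n \<and> i \<noteq> j"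
    and "{Inl i, Inr j} \<notin> E" and "{Inr j, Inl i} \<notin> E"
proof -
  have l: "{inc i, inc j} = inc ` f \<longleftrightarrow> f = {i, j}" if "inj inc"
    for f and i j and inc :: "nat \<Rightarrow> nat + nat"
    using inj_image_eq_iff[OF that, of "{i, j}" f] by auto
  have *: "card {i, j} = 2 \<longleftrightarrow> i \<noteq> j" for i j :: nat by (simp add: card_insert_if)
  show "{Inl i, Inl j} \<in> E \<longleftrightarrow> i < n \<and> j < n \<and> i \<noteq> j"
    using l[of Inl i j] * by (auto simp: E_def disjoint_union_graph_def complete_graph_def image_iff)
  show "{Inr i, Inr j} \<in> E \<longleftrightarrow> i < n \<and> j < n \<and> i \<noteq> j"
    using l[of Inr i j] * by (auto simp: E_def disjoint_union_graph_def complete_graph_def image_iff)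
  show "{Inl i, Inr j} \<notin> E" "{Inr j, Inl i} \<notin> E"
    by (auto simp: E_def disjoint_union_graph_def)
qed

lemma finite_edges: "finite_simple_graph G \<Longrightarrow> finite (edges G)"
  unfolding finite_simple_graph_def by (rule finite_subset[of _ "Pow (verts G)"]) auto

lemma edge_order_refining_levels:
  fixes lev :: "'a set \<Rightarrow> nat"
  assumes "finite (edges G)"
  obtains r where "edge_order G r"
    "\<And>e f. e \<in> edges G \<Longrightarrow> f \<in> edges G \<Longrightarrow> lev e < lev f \<Longrightarrow> (e, f) \<in> r"
proof -
  obtain idx :: "'a set \<Rightarrow> nat" where idx: "inj_on idx (edges G)"
    using finite_imp_inj_to_nat_seg[OF assms] by blast
  define r where "r = {(e, f). e \<in> edges G \<and> f \<in> edges G \<and>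
    (lev e < lev f \<or> lev e = lev f \<and> idx e < idx f)}"
  have "edge_order G r"
    unfolding edge_order_def strict_linear_order_on_def
  proof (intro conjI)
    show "total_on (edges G) r"
      using idx by (auto simp: total_on_def r_def inj_on_def not_less_iff_gr_or_eq)
         (metis linorder_neqE_nat)+
  qed (auto simp: r_def intro!: transI irreflI)
  then show ?thesis using that[of r] by (auto simp: r_def)
qed

definition edge_rank :: "'a set rel \<Rightarrow> 'a set \<Rightarrow> nat" where
  "edge_rank r e = card {f. (f, e) \<in> r}"

lemma edge_rank_less_iff:
  assumes "edge_order G r" "finite (edges G)" "e \<in> edges G" "f \<in> edges G"
  shows "edge_rank r e < edge_rank r f \<longleftrightarrow> (e, f) \<in> r"
    and "edge_rank r e = edge_rank r f \<longleftrightarrow> e = f"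
proof -
  have r: "r \<subseteq> edges G \<times> edges G" "trans r" "irrefl r" "total_on (edges G) r"
    using assms(1) by (auto simp: edge_order_def strict_linear_order_on_def)
  have mono: "edge_rank r a < edge_rank r b" if "(a, b) \<in> r" for a b
    unfolding edge_rank_def
  proof (rule psubset_card_mono)
    show "finite {f. (f, b) \<in> r}"
      by (rule finite_subset[OF _ assms(2)]) (use r(1) in auto)
    show "{f. (f, a) \<in> r} \<subset> {f. (f, b) \<in> r}"
      using that r(2,3) by (auto simp: irrefl_def dest: transD)
  qed
  show "edge_rank r e < edge_rank r f \<longleftrightarrow> (e, f) \<in> r" "edge_rank r e = edge_rank r f \<longleftrightarrow> e = f"
    using mono[of e f] mono[of f e] r(4) assms(3,4) by (force simp: total_on_def)+
qed

section \<open>An edge order without realization in low dimension\<close>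

text \<open>The order has three levels: edges of the first copy across its balanced bipartition, then all edges of
  the second copy, then the remaining edges of the first copy. Ties within a level are broken
  arbitrarily.\<close>

lemma unrealizable_edge_order:
  fixes n :: nat
  defines "G \<equiv> disjoint_union_graph (complete_graph n) (complete_graph n)"
  assumes "n \<ge> 2"
  obtains r where "edge_order G r" "\<And>d. d + 2 \<le> n \<Longrightarrow> \<not> realizable G r d"
proof -
  define s where "s = n div 2"
  have s: "0 < s" "s < n" using assms by (auto simp: s_def)
  define lev :: "(nat + nat) set \<Rightarrow> nat" where
    "lev e = (if e \<subseteq> range Inr then 1
      else if (\<exists>i\<in>{..<s}. Inl i \<in> e) \<and> (\<exists>j\<in>{s..}. Inl j \<in> e) then 0 else 2)" for e
  have lev1: "lev {Inr i, Inr j} = 1" for i j by (simp add: lev_def)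
  have lev0: "lev {Inl i, Inl j} = 0" if "i < s" "s \<le> j" for i j
    using that by (auto simp: lev_def)
  have lev2: "lev {Inl i, Inl j} = 2" if "i < s \<longleftrightarrow> j < s" for i j
    using that by (auto simp: lev_def)
  have fin: "finite (edges G)"
    unfolding G_def
    by (intro finite_edges finite_simple_graph_disjoint_union finite_simple_graph_complete)
  obtain r where r: "edge_order G r"
    "\<And>e f. e \<in> edges G \<Longrightarrow> f \<in> edges G \<Longrightarrow> lev e < lev f \<Longrightarrow> (e, f) \<in> r"
    using edge_order_refining_levels[OF fin, of lev] by blast
  have "\<not> realizable G r d" if d: "d + 2 \<le> n" for d
  proof
    assume "realizable G r d"
    then obtain p where p: "\<forall>u v x y. {u, v} \<in> edges G \<and> {x, y} \<in> edges G \<and> {u, v} \<noteq> {x, y} \<longrightarrow>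
        euclid_dist d (p u) (p v) \<noteq> euclid_dist d (p x) (p y) \<and>
        (({u, v}, {x, y}) \<in> r \<longleftrightarrow> euclid_dist d (p u) (p v) < euclid_dist d (p x) (p y))"
      unfolding realizable_def by (elim exE conjE) (rule that)
    have less: "sq_dist d (p u) (p v) < sq_dist d (p x) (p y)"
      if e: "{u, v} \<in> edges G" "{x, y} \<in> edges G" and lt: "lev {u, v} < lev {x, y}" for u v x y
    proof -
      have "({u, v}, {x, y}) \<in> r" using r(2) e lt by simp
      moreover have "{u, v} \<noteq> {x, y}" using lt by auto
      ultimately have "euclid_dist d (p u) (p v) < euclid_dist d (p x) (p y)"
        using p[rule_format, of u v x y] e by simp
      then show ?thesis by (simp only: euclid_dist_less_iff)
    qed
    define V where "V = {(i, j). i < n \<and> j < n \<and> i \<noteq> j}"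
    define D where "D = (\<lambda>(i, j). sq_dist d (p (Inr i)) (p (Inr j))) ` V"
    have "V \<subseteq> {..<n} \<times> {..<n}" by (auto simp: V_def)
    then have "finite D" unfolding D_def by (intro finite_imageI finite_subset[of V]) auto
    have "(0, 1) \<in> V" using assms by (auto simp: V_def)
    then have "D \<noteq> {}" by (auto simp: D_def)
    have Min: "Min D \<in> D" and Max: "Max D \<in> D" using \<open>finite D\<close> \<open>D \<noteq> {}\<close> by simp_all
    have "2 * Min D \<le> Max D * (2 - (1 / real (n div 2) + 1 / real (n - n div 2)))"
    proof (rule spread_of_dependent_points[OF d])
      show "0 \<le> Max D" using Max by (auto simp: D_def sum_nonneg)
      fix i j assume "i < n" "j < n" "i \<noteq> j"
      then have "sq_dist d (p (Inr i)) (p (Inr j)) \<in> D" by (auto simp: D_def V_def image_iff)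
      then show "Min D \<le> sq_dist d (p (Inr i)) (p (Inr j)) \<and> sq_dist d (p (Inr i)) (p (Inr j)) \<le> Max D"
        using \<open>finite D\<close> by simp
    qed
    moreover have "Max D * (2 - (1 / real s + 1 / real (n - s))) < 2 * Min D"
    proof (rule bipartite_gap_upper_bound[OF s])
      fix i j assume ij: "i < s" "s \<le> j" "j < n"
      obtain k l where kl: "k < n" "l < n" "k \<noteq> l" "Min D = sq_dist d (p (Inr k)) (p (Inr l))"
        using Min by (auto simp: D_def V_def)
      show "sq_dist d (p (Inl i)) (p (Inl j)) < Min D"
        unfolding kl(4) by (rule less) (use ij kl s in \<open>auto simp: G_def edge_simps lev0 lev1\<close>)
    next
      fix i j assume ij: "i < n" "j < n" "i \<noteq> j" "i < s \<longleftrightarrow> j < s"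
      obtain k l where kl: "k < n" "l < n" "k \<noteq> l" "Max D = sq_dist d (p (Inr k)) (p (Inr l))"
        using Max by (auto simp: D_def V_def)
      show "Max D \<le> sq_dist d (p (Inl i)) (p (Inl j))"
        unfolding kl(4)
        by (rule less_imp_le, rule less) (use ij kl s in \<open>auto simp: G_def edge_simps lev1 lev2\<close>)
    qed
    ultimately show False by (simp add: s_def)
  qed
  then show ?thesis using that r(1) by blast
qed

section \<open>Perturbing a regular simplex\<close>

text \<open>The centred regular simplex with \<open>m = n - 1\<close> coordinates: \<open>m\<close> vertices \<open>e\<^sub>i + a (1, \<dots>, 1)\<close> and one vertex
  \<open>b (1, \<dots>, 1)\<close>. With \<open>s = \<surd>n\<close>, centring requires \<open>b = - (1 + m a)\<close>, and the prescribed Gram matrix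
  leads to a quadratic equation for \<open>a\<close>, one of whose roots is \<open>- 1 / (s (s + 1))\<close>; then \<open>b = - 1 / s\<close>.\<close>

lemma regular_simplex:
  fixes n :: nat
  assumes "n \<ge> 1"
  obtains v :: "nat \<Rightarrow> nat \<Rightarrow> real" where "\<And>i k. n - 1 \<le> k \<Longrightarrow> v i k = 0"
    "\<And>i j. i < n \<Longrightarrow> j < n \<Longrightarrow> (\<Sum>k<n - 1. v i k * v j k) = (if i = j then 1 else 0) - 1 / n"
proof -
  define m where "m = n - 1"
  define s where "s = sqrt n"
  define a b where "a = - 1 / (s * (s + 1))" and "b = - 1 / s"
  have s0: "s > 0" using assms by (simp add: s_def)
  have ss: "s * s = real n" by (simp add: s_def)
  have m: "real m = (s - 1) * (s + 1)" using assms by (simp add: m_def algebra_simps ss of_nat_diff)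
  define v :: "nat \<Rightarrow> nat \<Rightarrow> real" where
    "v i k = (if k < m then if i < m then (if k = i then 1 else 0) + a else b else 0)" for i k
  have "m * a = - (s - 1) / s"
    unfolding m a_def using s0 by (simp add: divide_simps)
  then have ma: "1 + m * a = 1 / s" using s0 by (simp add: field_simps)
  have "2 * a + m * (a * a) = a * (1 + (1 + m * a))" by (simp add: algebra_simps)
  also have "\<dots> = - 1 / n" unfolding ma unfolding a_def ss[symmetric] using s0 by (simp add: divide_simps)
  finally have aa: "2 * a + m * (a * a) = - 1 / n" .
  have ab: "b * (1 + m * a) = - 1 / n" unfolding ma unfolding b_def ss[symmetric] by simp
  have bb: "m * (b * b) = 1 - 1 / n"
    unfolding m b_def ss[symmetric] using s0 by (simp add: field_simps)
  have "(\<Sum>k<m. v i k * v j k) = (if i = j then 1 else 0) - 1 / n" if "i < n" "j < n" for i j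
  proof -
    consider "i < m" "j < m" | "i < m" "j = m" | "i = m" "j < m" | "i = m" "j = m"
      using \<open>i < n\<close> \<open>j < n\<close> unfolding m_def by linarith
    then show ?thesis
    proof cases
      case 1
      have "(\<Sum>k<m. v i k * v j k) = (\<Sum>k<m. (if k = i then (if i = j then 1 else 0) + a else 0)
          + (if k = j then a else 0) + a * a)"
        using 1 by (intro sum.cong) (auto simp: v_def algebra_simps)
      also have "\<dots> = (if i = j then 1 else 0) + (2 * a + m * (a * a))"
        using 1 by (simp add: sum.distrib)
      finally show ?thesis using aa by simp
    next
      case 2
      have "(\<Sum>k<m. v i k * v j k) = (\<Sum>k<m. (if k = i then b else 0) + a * b)"
        using 2 by (intro sum.cong) (auto simp: v_def algebra_simps)
      also have "\<dots> = b * (1 + m * a)" using 2 by (simp add: sum.distrib algebra_simps)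
      finally show ?thesis using ab 2 by simp
    next
      case 3
      have "(\<Sum>k<m. v i k * v j k) = (\<Sum>k<m. (if k = j then b else 0) + a * b)"
        using 3 by (intro sum.cong) (auto simp: v_def algebra_simps)
      also have "\<dots> = b * (1 + m * a)" using 3 by (simp add: sum.distrib algebra_simps)
      finally show ?thesis using ab 3 by simp
    next
      case 4
      have "(\<Sum>k<m. v i k * v j k) = m * (b * b)" using 4 by (simp add: v_def)
      then show ?thesis using bb 4 by simp
    qed
  qed
  moreover have "v i k = 0" if "n - 1 \<le> k" for i k using that by (simp add: v_def m_def)
  ultimately show ?thesis using that unfolding m_def by blast
qed

text \<open>The Gram matrix gives \<open>(v\<^sub>i - v\<^sub>j) \<bullet> v\<^sub>l = \<delta>\<^sub>i\<^sub>l - \<delta>\<^sub>j\<^sub>l\<close>. So moving each \<open>v\<^sub>i\<close> by \<open>- \<epsilon> \<Sum>\<^sub>l w\<^sub>i\<^sub>l v\<^sub>l\<close>, with \<open>w\<close> symmetric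
  and its diagonal set to zero, changes the squared distance of \<open>i\<close> and \<open>j\<close> to first order by a multiple
  of \<open>w\<^sub>i\<^sub>j\<close> alone. The second-order term \<open>Q\<close> is itself a squared distance, hence nonnegative.\<close>

lemma perturbed_regular_simplex:
  fixes n :: nat and w :: "nat \<Rightarrow> nat \<Rightarrow> real"
  assumes "n \<ge> 1" and sym: "\<And>i j. w i j = w j i"
  obtains p :: "real \<Rightarrow> nat \<Rightarrow> nat \<Rightarrow> real" and Q :: "nat \<Rightarrow> nat \<Rightarrow> real"
  where "\<And>\<epsilon> i k. n - 1 \<le> k \<Longrightarrow> p \<epsilon> i k = 0" "\<And>i j. Q i j \<ge> 0"
    "\<And>\<epsilon> i j. i < n \<Longrightarrow> j < n \<Longrightarrow> i \<noteq> j \<Longrightarrow>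
       sq_dist (n - 1) (p \<epsilon> i) (p \<epsilon> j) = 2 + 4 * \<epsilon> * w i j + \<epsilon>\<^sup>2 * Q i j"
proof -
  obtain v :: "nat \<Rightarrow> nat \<Rightarrow> real" where v0: "\<And>i k. n - 1 \<le> k \<Longrightarrow> v i k = 0"
    and gram: "\<And>i j. i < n \<Longrightarrow> j < n \<Longrightarrow> (\<Sum>k<n - 1. v i k * v j k) = (if i = j then 1 else 0) - 1 / n"
    using regular_simplex[OF assms(1)] by blast
  define z where "z i j = (if i = j then 0 else w i j)" for i j
  define u where "u i k = (\<Sum>l<n. z i l * v l k)" for i k
  define p where "p \<epsilon> i k = v i k - \<epsilon> * u i k" for \<epsilon> i k
  define Q where "Q i j = sq_dist (n - 1) (u i) (u j)" for i j
  have dual: "(\<Sum>k<n - 1. (v i k - v j k) * v l k) = (if i = l then 1 else 0) - (if j = l then 1 else 0)"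
    if "i < n" "j < n" "l < n" for i j l
    using that by (simp only: left_diff_distrib sum_subtractf gram)
  have "sq_dist (n - 1) (p \<epsilon> i) (p \<epsilon> j) = 2 + 4 * \<epsilon> * w i j + \<epsilon>\<^sup>2 * Q i j"
    if ij: "i < n" "j < n" "i \<noteq> j" for \<epsilon> i j
  proof -
    have "sq_dist (n - 1) (v i) (v j)
        = (\<Sum>k<n - 1. (v i k - v j k) * v i k) - (\<Sum>k<n - 1. (v i k - v j k) * v j k)"
      by (simp add: power2_eq_square algebra_simps flip: sum_subtractf)
    also have "\<dots> = 2" using ij by (simp only: dual) simp
    finally have base: "sq_dist (n - 1) (v i) (v j) = 2" .
    have "(\<Sum>k<n - 1. (v i k - v j k) * (u i k - u j k))
        = (\<Sum>k<n - 1. \<Sum>l<n. (z i l - z j l) * ((v i k - v j k) * v l k))"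
      by (simp add: u_def sum_distrib_left mult_ac left_diff_distrib flip: sum_subtractf)
        (simp add: algebra_simps)
    also have "\<dots> = (\<Sum>l<n. (z i l - z j l) * (\<Sum>k<n - 1. (v i k - v j k) * v l k))"
      by (subst sum.swap) (simp add: sum_distrib_left)
    also have "\<dots> = (\<Sum>l<n. (if i = l then z i l - z j l else 0) - (if j = l then z i l - z j l else 0))"
      using ij by (intro sum.cong refl) (subst dual; simp)
    also have "\<dots> = - 2 * w i j"
      using ij by (simp add: sum_subtractf z_def sym[of j i])
    finally have lin: "(\<Sum>k<n - 1. (v i k - v j k) * (u i k - u j k)) = - 2 * w i j" .
    have "sq_dist (n - 1) (p \<epsilon> i) (p \<epsilon> j) = (\<Sum>k<n - 1. (v i k - v j k)\<^sup>2
        - 2 * \<epsilon> * ((v i k - v j k) * (u i k - u j k)) + \<epsilon>\<^sup>2 * (u i k - u j k)\<^sup>2)"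
      by (intro sum.cong) (auto simp: p_def power2_eq_square algebra_simps)
    also have "\<dots> = sq_dist (n - 1) (v i) (v j)
        - 2 * \<epsilon> * (\<Sum>k<n - 1. (v i k - v j k) * (u i k - u j k)) + \<epsilon>\<^sup>2 * Q i j"
      by (simp only: sum.distrib sum_subtractf sum_distrib_left Q_def)
    finally show ?thesis unfolding base lin by simp
  qed
  moreover have "p \<epsilon> i k = 0" if "n - 1 \<le> k" for \<epsilon> i k using that by (simp add: p_def u_def v0)
  moreover have "Q i j \<ge> 0" for i j by (simp add: Q_def sum_nonneg)
  ultimately show ?thesis using that by blast
qed

text \<open>Perturb both simplices in the direction of the edge ranks. Consecutive ranks differ by at least \<open>1\<close>, so
  the first-order terms of two edges differ by at least \<open>4 \<epsilon>\<close>; the second-order terms lie between \<open>0\<close>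
  and \<open>4 \<epsilon>\<close> as soon as \<open>\<epsilon> Q < 4\<close> for all of them.\<close>

lemma realizable_in_simplex_dimension:
  fixes n :: nat
  defines "G \<equiv> disjoint_union_graph (complete_graph n) (complete_graph n)"
  assumes "n \<ge> 2" and r: "edge_order G r"
  shows "realizable G r (n - 1)"
proof -
  have fin: "finite (edges G)"
    unfolding G_def
    by (intro finite_edges finite_simple_graph_disjoint_union finite_simple_graph_complete)
  have n1: "n \<ge> 1" using assms(2) by simp
  obtain pL QL where p0L: "\<And>\<epsilon> i k. n - 1 \<le> k \<Longrightarrow> pL \<epsilon> i k = 0"
    and Q0L: "\<And>i j. QL i j \<ge> 0"
    and pdL: "\<And>\<epsilon> i j. i < n \<Longrightarrow> j < n \<Longrightarrow> i \<noteq> j \<Longrightarrow>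
       sq_dist (n - 1) (pL \<epsilon> i) (pL \<epsilon> j)
         = 2 + 4 * \<epsilon> * real (edge_rank r {Inl i, Inl j}) + \<epsilon>\<^sup>2 * QL i j"
    by (rule perturbed_regular_simplex[OF n1, of "\<lambda>i j. real (edge_rank r {Inl i, Inl j})"])
      (simp add: insert_commute, rule that)
  obtain pR QR where p0R: "\<And>\<epsilon> i k. n - 1 \<le> k \<Longrightarrow> pR \<epsilon> i k = 0"
    and Q0R: "\<And>i j. QR i j \<ge> 0"
    and pdR: "\<And>\<epsilon> i j. i < n \<Longrightarrow> j < n \<Longrightarrow> i \<noteq> j \<Longrightarrow>
       sq_dist (n - 1) (pR \<epsilon> i) (pR \<epsilon> j)
         = 2 + 4 * \<epsilon> * real (edge_rank r {Inr i, Inr j}) + \<epsilon>\<^sup>2 * QR i j"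
    by (rule perturbed_regular_simplex[OF n1, of "\<lambda>i j. real (edge_rank r {Inr i, Inr j})"])
      (simp add: insert_commute, rule that)
  define C where "C = (\<Sum>i<n. \<Sum>j<n. QL i j + QR i j)"
  have QC: "QL i j + QR i j \<le> C" if "i < n" "j < n" for i j
  proof -
    have "QL i j + QR i j \<le> (\<Sum>j<n. QL i j + QR i j)"
      using that Q0L Q0R by (intro member_le_sum) auto
    also have "\<dots> \<le> C"
      unfolding C_def using that Q0L Q0R
      by (intro member_le_sum[of i _ "\<lambda>i. \<Sum>j<n. QL i j + QR i j"]) (auto intro!: sum_nonneg)
    finally show ?thesis .
  qed
  have "C \<ge> 0" by (simp add: C_def sum_nonneg Q0L Q0R)
  define \<epsilon> where "\<epsilon> = 1 / (C + 1)"
  have \<epsilon>: "\<epsilon> > 0" using \<open>C \<ge> 0\<close> by (simp add: \<epsilon>_def)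
  have small: "\<epsilon> * q < 4" if "q \<le> C" for q
    using that \<open>C \<ge> 0\<close> by (simp add: \<epsilon>_def divide_simps)
  \<comment> \<open>Shifting the second copy by \<open>\<tau>\<close> in one coordinate keeps it away from the first copy.\<close>
  have "finite ((\<lambda>(i, j). pL \<epsilon> i 0 - pR \<epsilon> j 0) ` ({..<n} \<times> {..<n}))" by simp
  then obtain \<tau> where new: "\<tau> \<notin> (\<lambda>(i, j). pL \<epsilon> i 0 - pR \<epsilon> j 0) ` ({..<n} \<times> {..<n})"
    using ex_new_if_finite[OF infinite_UNIV_char_0] by blast
  have \<tau>: "pL \<epsilon> i 0 \<noteq> pR \<epsilon> j 0 + \<tau>" if "i < n" "j < n" for i j
  proof
    assume "pL \<epsilon> i 0 = pR \<epsilon> j 0 + \<tau>"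
    then have "\<tau> = (\<lambda>(i, j). pL \<epsilon> i 0 - pR \<epsilon> j 0) (i, j)" by simp
    then show False using new that by blast
  qed
  define P where "P u = (case u of Inl i \<Rightarrow> pL \<epsilon> i
    | Inr i \<Rightarrow> (\<lambda>k. pR \<epsilon> i k + (if k = 0 then \<tau> else 0)))" for u :: "nat + nat"
  have dist_L: "sq_dist (n - 1) (P (Inl i)) (P (Inl j)) = sq_dist (n - 1) (pL \<epsilon> i) (pL \<epsilon> j)"
    and dist_R: "sq_dist (n - 1) (P (Inr i)) (P (Inr j)) = sq_dist (n - 1) (pR \<epsilon> i) (pR \<epsilon> j)" for i j
    by (simp_all add: P_def)
  have dist: "\<exists>q\<ge>0. \<epsilon> * q < 4 \<and>
      sq_dist (n - 1) (P u) (P v) = 2 + 4 * \<epsilon> * edge_rank r {u, v} + \<epsilon>\<^sup>2 * q"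
    if e: "{u, v} \<in> edges G" for u v
  proof (cases u)
    case (Inl i)
    then obtain j where v: "v = Inl j" using e by (cases v) (auto simp: G_def edge_simps)
    then have ij: "i < n" "j < n" "i \<noteq> j" using that Inl by (auto simp: G_def edge_simps)
    have "QL i j \<le> C" using QC[of i j] Q0R[of i j] ij by linarith
    then show ?thesis unfolding Inl v dist_L pdL[OF ij]
      by (intro exI[of _ "QL i j"] conjI Q0L small refl)
  next
    case (Inr i)
    then obtain j where v: "v = Inr j" using e by (cases v) (auto simp: G_def edge_simps)
    then have ij: "i < n" "j < n" "i \<noteq> j" using that Inr by (auto simp: G_def edge_simps)
    have "QR i j \<le> C" using QC[of i j] Q0L[of i j] ij by linarith
    then show ?thesis unfolding Inr v dist_R pdR[OF ij]
      by (intro exI[of _ "QR i j"] conjI Q0R small refl)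
  qed
  have mono: "sq_dist (n - 1) (P u) (P v) < sq_dist (n - 1) (P x) (P y)"
    if e: "{u, v} \<in> edges G" "{x, y} \<in> edges G" and lt: "edge_rank r {u, v} < edge_rank r {x, y}" for u v x y
  proof -
    let ?a = "edge_rank r {u, v}" and ?b = "edge_rank r {x, y}"
    obtain q where q: "\<epsilon> * q < 4" "sq_dist (n - 1) (P u) (P v) = 2 + 4 * \<epsilon> * ?a + \<epsilon>\<^sup>2 * q"
      using dist[OF e(1)] by blast
    obtain q' where q': "q' \<ge> 0" "sq_dist (n - 1) (P x) (P y) = 2 + 4 * \<epsilon> * ?b + \<epsilon>\<^sup>2 * q'"
      using dist[OF e(2)] by blast
    have "\<epsilon> * (\<epsilon> * q) < \<epsilon> * 4" using q(1) \<epsilon> by simp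
    moreover have "\<epsilon> * (real ?a + 1) \<le> \<epsilon> * real ?b" using lt \<epsilon> by (intro mult_left_mono) auto
    moreover have "0 \<le> \<epsilon>\<^sup>2 * q'" using q'(1) by simp
    ultimately show ?thesis unfolding q(2) q'(2) by (simp add: power2_eq_square algebra_simps)
  qed
  have order: "euclid_dist (n - 1) (P u) (P v) \<noteq> euclid_dist (n - 1) (P x) (P y) \<and>
       (({u, v}, {x, y}) \<in> r \<longleftrightarrow> euclid_dist (n - 1) (P u) (P v) < euclid_dist (n - 1) (P x) (P y))"
    if e: "{u, v} \<in> edges G" "{x, y} \<in> edges G" "{u, v} \<noteq> {x, y}" for u v x y
  proof -
    have "edge_rank r {u, v} \<noteq> edge_rank r {x, y}"
      using edge_rank_less_iff(2)[OF r fin e(1,2)] e(3) by simp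
    then consider "edge_rank r {u, v} < edge_rank r {x, y}" | "edge_rank r {x, y} < edge_rank r {u, v}"
      by linarith
    then show ?thesis
      using mono[OF e(1,2)] mono[OF e(2,1)] edge_rank_less_iff(1)[OF r fin e(1,2)]
      unfolding euclid_dist_less_iff euclid_dist_eq_iff by cases auto
  qed
  have edge_inj: "P u \<noteq> P v" if e: "{u, v} \<in> edges G" for u v
  proof
    assume "P u = P v"
    moreover obtain q where "q \<ge> 0" "sq_dist (n - 1) (P u) (P v) = 2 + 4 * \<epsilon> * edge_rank r {u, v} + \<epsilon>\<^sup>2 * q"
      using dist[OF e] by blast
    moreover have "0 \<le> 4 * \<epsilon> * edge_rank r {u, v}" using \<epsilon> by simp
    moreover have "0 \<le> \<epsilon>\<^sup>2 * q" using \<open>q \<ge> 0\<close> by simp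
    ultimately show False by simp
  qed
  have cross: "P (Inl i) \<noteq> P (Inr j)" if "i < n" "j < n" for i j
    using \<tau>[OF that] by (auto simp: P_def dest: fun_cong[of _ _ 0])
  have verts: "verts G = Inl ` {..<n} \<union> Inr ` {..<n}"
    by (auto simp: G_def disjoint_union_graph_def complete_graph_def)
  have inj: "inj_on P (verts G)"
    unfolding inj_on_def
  proof (intro ballI impI)
    fix u v assume uv: "u \<in> verts G" "v \<in> verts G" "P u = P v"
    then have "{u, v} \<notin> edges G" using edge_inj by blast
    then show "u = v"
      using uv cross cross[symmetric] by (auto simp: verts edge_simps[of _ _ n, folded G_def])
  qed
  have "P u \<in> topspace (Euclidean_space (n - 1))" for u
    using p0L p0R assms(2) by (auto simp: topspace_Euclidean_space P_def split: sum.split)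
  then show ?thesis
    unfolding realizable_def using inj order by (intro exI[of _ P]) auto
qed

theorem theorem17:
  fixes n :: nat
  assumes "n \<ge> 3"
  shows "realization_dim (disjoint_union_graph (complete_graph n) (complete_graph n)) = n - 1
    \<and> (\<forall>r. edge_order (disjoint_union_graph (complete_graph n) (complete_graph n)) r \<longrightarrow>
          realizable (disjoint_union_graph (complete_graph n) (complete_graph n)) r (n - 1))
    \<and> (\<exists>r. edge_order (disjoint_union_graph (complete_graph n) (complete_graph n)) r \<and>
          \<not> realizable (disjoint_union_graph (complete_graph n) (complete_graph n)) r (n - 2))"
proof -
  let ?G = "disjoint_union_graph (complete_graph n) (complete_graph n)"
  have upper: "\<forall>r. edge_order ?G r \<longrightarrow> realizable ?G r (n - 1)"
    using realizable_in_simplex_dimension assms by simp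
  obtain r where r: "edge_order ?G r" "\<And>d. d + 2 \<le> n \<Longrightarrow> \<not> realizable ?G r d"
    using unrealizable_edge_order[of n] assms by auto
  have "realization_dim ?G = n - 1"
    unfolding realization_dim_def
  proof (rule Least_equality)
    show "\<forall>r. edge_order ?G r \<longrightarrow> realizable ?G r (n - 1)" by (rule upper)
  next
    fix d assume "\<forall>r. edge_order ?G r \<longrightarrow> realizable ?G r d"
    then show "n - 1 \<le> d" using r(1) r(2)[of d] by fastforce
  qed
  moreover have "\<not> realizable ?G r (n - 2)" using r(2)[of "n - 2"] assms by simp
  ultimately show ?thesis using upper r(1) by blast
qed

end
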